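(* Let $r$ be a positive integer. All the absentee-voxels of the hemisphere of revolution $\mathcal H_\cup^{\mathbb Z}(r)$ in Octant 1 and Octant 8 (that is, all absentee-voxels $(x,y,z)$ with $|x|\le z$) lie in the family $$\mathcal F=\{P_h\cap\mathbb Z_1^3:\ h=0,1,2,\ldots\},$$ i.e. each of them belongs to $P_h\cap\mathbb Z_1^3$ for some integer $h\ge0$, where $P_h=\{(x,y,z)\in\mathbb R^3:\ (2h+1)z+h^2\le x^2<(2h+1)z+(h+1)^2\}$ and $\mathbb Z_1^3=\{(x,y,z)\in\mathbb Z^3: |x|\le z\}$.
   Context: Digital circle of integer radius $r\ge 0$: $\mathcal C^{\mathbb Z}(r)=\{(i,j)\in\mathbb Z^2: |\max(|i|,|j|)-\sqrt{r^2-\min(|i|,|j|)^2}|<\tfrac12\}$ (points for which the square root is not real are excluded). Digital disc: $\mathcal D^{\mathbb Z}(r)$ is the set of all $(i,j_c)\in\mathbb Z^2$ for which there is $(i_c,j_c)\in\mathcal C^{\mathbb Z}(r)$ with $i$ between $0$ and $i_c$ inclusive. The interior of $\mathcal C^{\mathbb Z}(r)$ is $\mathcal D^{\mathbb Z}(r)\setminus\mathcal C^{\mathbb Z}(r)$ and its exterior is $\mathbb Z^2\setminus\mathcal D^{\mathbb Z}(r)$. Coordinates in $\mathbb Z^3$ are $(x,y,z)$. For $c=(0,j,0)$ and an integer $i\ge0$, $\mathcal C^{\mathbb Z}(c,i)=\{(x,j,z):(x,z)\in\mathcal C^{\mathbb Z}(i)\}$, with interior and exterior taken within the plane $y=j$.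 The generatrix $\mathcal C_{1,2}^{\mathbb Z}(r)$ is the part of $\mathcal C^{\mathbb Z}(r)$ in the first quadrant $\{i\ge0,\ j\ge0\}$, regarded as a sequence ordered from $(0,r)$ to $(r,0)$. The hemisphere of revolution is $\mathcal H_\cup^{\mathbb Z}(r)=\bigcup_{(i,j)\in\mathcal C_{1,2}^{\mathbb Z}(r)}\mathcal C^{\mathbb Z}((0,j,0),i)$. A voxel $p$ in the plane $y=j$ is an absentee-voxel of $\mathcal H_\cup^{\mathbb Z}(r)$ iff there are two consecutive points $(i,j)$ and $(i-1,j')$, $j'\in\{j,j+1\}$, of the generatrix such that $p$ lies in the interior of $\mathcal C^{\mathbb Z}(c,i)$ and in the exterior of $\mathcal C^{\mathbb Z}(c,i-1)$, where $c=(0,j,0)$. Octants refer to the $zx$-coordinates: Octant 1 is $0\le x\le z$ and Octant 8 is $0\le -x\le z$. *)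

theory Defs
  imports Complex_Main
begin

(* Points of Z^2 are pairs, voxels (points of Z^3) are triples (x, y, z). Radii are integers
   and are meant to be nonnegative; they are signed so that the radius i - 1 needs no
   truncated subtraction. *)

type_synonym voxel = "int \<times> int \<times> int"

(* HOL's sqrt is total (sqrt of a negative number is negative), so the points at which the
   square root is not real are excluded by the first conjunct. *)
definition dcircle :: "int \<Rightarrow> (int \<times> int) set" where
  "dcircle r = {(i, j). (min \<bar>i\<bar> \<bar>j\<bar>)\<^sup>2 \<le> r\<^sup>2 \<and>
     \<bar>real_of_int (max \<bar>i\<bar> \<bar>j\<bar>) - sqrt (real_of_int (r\<^sup>2 - (min \<bar>i\<bar> \<bar>j\<bar>)\<^sup>2))\<bar> < 1 / 2}"

definition ddisc :: "int \<Rightarrow> (int \<times> int) set" where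
  "ddisc r = {(i, jc). \<exists>ic. (ic, jc) \<in> dcircle r \<and> min 0 ic \<le> i \<and> i \<le> max 0 ic}"

definition dinterior :: "int \<Rightarrow> (int \<times> int) set" where
  "dinterior r = ddisc r - dcircle r"

definition dexterior :: "int \<Rightarrow> (int \<times> int) set" where
  "dexterior r = - ddisc r"

definition in_plane :: "int \<Rightarrow> (int \<times> int) set \<Rightarrow> voxel set" where
  "in_plane j A = {(x, y, z). y = j \<and> (x, z) \<in> A}"

(* The circle of radius i centred at (0, j, 0) is in_plane j (dcircle i); its interior and
   exterior within the plane y = j are in_plane j (dinterior i) and in_plane j (dexterior i). *)

definition generatrix :: "int \<Rightarrow> (int \<times> int) set" where
  "generatrix r = {(i, j) \<in> dcircle r. 0 \<le> i \<and> 0 \<le> j}"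

(* The order in which the first quadrant is traversed from (0, r) to (r, 0): rightwards, and
   downwards within a column. *)
definition walk_less :: "int \<times> int \<Rightarrow> int \<times> int \<Rightarrow> bool" where
  "walk_less p q \<longleftrightarrow> fst p < fst q \<or> fst p = fst q \<and> snd p > snd q"

definition walk_le :: "int \<times> int \<Rightarrow> int \<times> int \<Rightarrow> bool" where
  "walk_le p q \<longleftrightarrow> walk_less p q \<or> p = q"

definition generatrix_seq :: "int \<Rightarrow> (int \<times> int) list" where
  "generatrix_seq r = linorder.sorted_list_of_set walk_le (generatrix r)"

definition consecutive :: "int \<Rightarrow> int \<times> int \<Rightarrow> int \<times> int \<Rightarrow> bool" where
  "consecutive r p q \<longleftrightarrow>
     (\<exists>n. Suc n < length (generatrix_seq r) \<and>
          generatrix_seq r ! n = p \<and> generatrix_seq r ! Suc n = q)"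

definition hemisphere :: "int \<Rightarrow> voxel set" where
  "hemisphere r = (\<Union>(i, j) \<in> generatrix r. in_plane j (dcircle i))"

(* Absentee-voxels of hemisphere r. Since the first coordinate is nondecreasing along the
   generatrix, (i - 1, j') is the predecessor of (i, j). *)
definition absentee_voxels :: "int \<Rightarrow> voxel set" where
  "absentee_voxels r = {p. \<exists>i j j'. j' \<in> {j, j + 1} \<and> consecutive r (i - 1, j') (i, j) \<and>
     p \<in> in_plane j (dinterior i) \<and> p \<in> in_plane j (dexterior (i - 1))}"

(* Octants refer to the zx-coordinates. *)
definition octant1 :: "voxel set" where
  "octant1 = {(x, y, z). 0 \<le> x \<and> x \<le> z}"

definition octant8 :: "voxel set" where
  "octant8 = {(x, y, z). 0 \<le> - x \<and> - x \<le> z}"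

definition P_region :: "nat \<Rightarrow> (real \<times> real \<times> real) set" where
  "P_region h = {(x, y, z). (2 * real h + 1) * z + (real h)\<^sup>2 \<le> x\<^sup>2 \<and>
       x\<^sup>2 < (2 * real h + 1) * z + (real h + 1)\<^sup>2}"

definition Z3_1 :: "(real \<times> real \<times> real) set" where
  "Z3_1 = {(x, y, z). x \<in> \<int> \<and> y \<in> \<int> \<and> z \<in> \<int> \<and> \<bar>x\<bar> \<le> z}"

definition family_F :: "(real \<times> real \<times> real) set set" where
  "family_F = {P_region h \<inter> Z3_1 | h. True}"

definition real_point :: "voxel \<Rightarrow> real \<times> real \<times> real" where
  "real_point = (\<lambda>(x, y, z). (real_of_int x, real_of_int y, real_of_int z))"

lemma linorder_walk: "class.linorder walk_le walk_less"
  by unfold_locales (auto simp: walk_le_def walk_less_def prod_eq_iff)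

lemma finite_generatrix: "finite (generatrix r)"
proof (rule finite_subset)
  show "generatrix r \<subseteq> {0..\<bar>r\<bar> + 1} \<times> {0..\<bar>r\<bar> + 1}"
  proof clarify
    fix i j assume "(i, j) \<in> generatrix r"
    hence nn: "0 \<le> i" "0 \<le> j"
      and d: "\<bar>real_of_int (max i j) - sqrt (real_of_int (r\<^sup>2 - (min i j)\<^sup>2))\<bar> < 1 / 2"
      by (auto simp: generatrix_def dcircle_def)
    have "sqrt (real_of_int (r\<^sup>2 - (min i j)\<^sup>2)) \<le> sqrt ((real_of_int r)\<^sup>2)"
      by (rule real_sqrt_le_mono) simp
    also have "\<dots> = real_of_int \<bar>r\<bar>" by simp
    finally have "real_of_int (max i j) < real_of_int \<bar>r\<bar> + 1"
      using d by linarith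
    hence "real_of_int (max i j) < real_of_int (\<bar>r\<bar> + 1)" by simp
    hence "max i j < \<bar>r\<bar> + 1"
      by (simp only: of_int_less_iff)
    with nn show "i \<in> {0..\<bar>r\<bar> + 1} \<and> j \<in> {0..\<bar>r\<bar> + 1}" by auto
  qed
qed simp

lemma generatrix_seq:
  "set (generatrix_seq r) = generatrix r" "sorted_wrt walk_less (generatrix_seq r)"
proof -
  interpret walk: linorder walk_le walk_less by (rule linorder_walk)
  show "set (generatrix_seq r) = generatrix r"
    unfolding generatrix_seq_def by (simp add: finite_generatrix)
  show "sorted_wrt walk_less (generatrix_seq r)"
    unfolding generatrix_seq_def by (rule walk.strict_sorted_list_of_set)
qed

end

(* In the octants |x| <= z, a point lies strictly inside the circle of radius k only if
   x^2 + z^2 + z < k^2, and it lies outside the circle of radius k - 1 only if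
   (k - 1)^2 <= x^2 + z^2 - z. With h = k - 1 - z these two inequalities are exactly the two
   that define P_h. *)

theory Submission
  imports Defs
begin

text \<open>Squaring \<open>M + 1/2\<close> and \<open>M - 1/2\<close> leaves a surplus of
  \<open>1/4\<close>, which integrality absorbs. For \<open>M = 0\<close> the number
  \<open>M - 1/2\<close> is negative and the lower bound is automatic.\<close>

lemma abs_diff_sqrt_less_half_iff:
  fixes M N :: int
  assumes "0 \<le> M" "0 \<le> N"
  shows "\<bar>real_of_int M - sqrt (real_of_int N)\<bar> < 1 / 2 \<longleftrightarrow>
    N \<le> M\<^sup>2 + M \<and> (M = 0 \<or> M\<^sup>2 - M < N)"
proof -
  have "sqrt (real_of_int N) < real_of_int M + 1 / 2 \<longleftrightarrow>
      real_of_int N < (real_of_int M + 1 / 2)\<^sup>2"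
    using assms real_sqrt_less_iff[of "real_of_int N" "(real_of_int M + 1 / 2)\<^sup>2"] by simp
  also have "\<dots> \<longleftrightarrow> real_of_int N < real_of_int (M\<^sup>2 + M) + 1 / 4"
    by (simp add: power2_eq_square algebra_simps)
  also have "\<dots> \<longleftrightarrow> N \<le> M\<^sup>2 + M"
    by linarith
  finally have upper: "sqrt (real_of_int N) < real_of_int M + 1 / 2 \<longleftrightarrow> N \<le> M\<^sup>2 + M" .
  have lower: "real_of_int M - 1 / 2 < sqrt (real_of_int N) \<longleftrightarrow> M\<^sup>2 - M < N" if "M \<noteq> 0"
  proof -
    have "0 \<le> real_of_int M - 1 / 2"
      using that assms by linarith
    hence "real_of_int M - 1 / 2 < sqrt (real_of_int N) \<longleftrightarrow>
        (real_of_int M - 1 / 2)\<^sup>2 < real_of_int N"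
      using real_sqrt_less_iff[of "(real_of_int M - 1 / 2)\<^sup>2" "real_of_int N"] by simp
    also have "\<dots> \<longleftrightarrow> real_of_int (M\<^sup>2 - M) + 1 / 4 < real_of_int N"
      by (simp add: power2_eq_square algebra_simps)
    also have "\<dots> \<longleftrightarrow> M\<^sup>2 - M < N"
      by linarith
    finally show ?thesis .
  qed
  have "0 \<le> sqrt (real_of_int N)"
    using assms by simp
  with upper lower show ?thesis
    unfolding abs_less_iff by (cases "M = 0") auto
qed

lemma dcircle_iff_steep:
  assumes "\<bar>i\<bar> \<le> j"
  shows "(i, j) \<in> dcircle r \<longleftrightarrow>
    i\<^sup>2 \<le> r\<^sup>2 \<and> r\<^sup>2 - i\<^sup>2 \<le> j\<^sup>2 + j \<and> (j = 0 \<or> j\<^sup>2 - j < r\<^sup>2 - i\<^sup>2)"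
proof -
  have j: "0 \<le> j" and "min \<bar>i\<bar> \<bar>j\<bar> = \<bar>i\<bar>" "max \<bar>i\<bar> \<bar>j\<bar> = j"
    using assms by linarith+
  hence "(i, j) \<in> dcircle r \<longleftrightarrow>
      i\<^sup>2 \<le> r\<^sup>2 \<and> \<bar>real_of_int j - sqrt (real_of_int (r\<^sup>2 - i\<^sup>2))\<bar> < 1 / 2"
    by (simp only: dcircle_def mem_Collect_eq prod.case power2_abs)
  thus ?thesis
    using abs_diff_sqrt_less_half_iff[OF j, of "r\<^sup>2 - i\<^sup>2"]
    by (metis diff_ge_0_iff_ge)
qed

lemma dcircle_swap: "(i, j) \<in> dcircle r \<longleftrightarrow> (j, i) \<in> dcircle r"
  by (simp only: dcircle_def mem_Collect_eq prod.case min.commute max.commute)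

lemma dcircle_abs: "(\<bar>i\<bar>, j) \<in> dcircle r \<longleftrightarrow> (i, j) \<in> dcircle r"
  by (simp only: dcircle_def mem_Collect_eq prod.case abs_idempotent)

text \<open>Reflection in the diagonal reduces this to the steep case, whose second coordinate must
  be nonnegative; hence \<open>\<bar>i\<bar>\<close>.\<close>

lemma dcircle_iff_flat:
  assumes "0 \<le> j" "j \<le> \<bar>i\<bar>"
  shows "(i, j) \<in> dcircle r \<longleftrightarrow>
    j\<^sup>2 \<le> r\<^sup>2 \<and> r\<^sup>2 - j\<^sup>2 \<le> \<bar>i\<bar>\<^sup>2 + \<bar>i\<bar> \<and> (\<bar>i\<bar> = 0 \<or> \<bar>i\<bar>\<^sup>2 - \<bar>i\<bar> < r\<^sup>2 - j\<^sup>2)"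
proof -
  have "\<bar>j\<bar> \<le> \<bar>i\<bar>"
    using assms by simp
  from dcircle_iff_steep[OF this, of r] show ?thesis
    by (simp only: dcircle_swap[of j] dcircle_abs)
qed

text \<open>Let \<open>u\<close> be the circle point of row \<open>z\<close> that puts
  \<open>x\<close> in the disc. If \<open>\<bar>u\<bar> \<le> z\<close>, the lower end of the window
  passes from \<open>u\<close> to \<open>x\<close>, so \<open>x\<close> can miss the circle only by
  violating the upper end. If \<open>u\<close> lies beyond the diagonal, its window alone gives the
  bound.\<close>

lemma dinterior_bound:
  assumes "(x, z) \<in> dinterior k" "\<bar>x\<bar> \<le> z"
  shows "x\<^sup>2 + z\<^sup>2 + z < k\<^sup>2"
proof -
  obtain u where u: "(u, z) \<in> dcircle k" "min 0 u \<le> x" "x \<le> max 0 u"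
    and off: "(x, z) \<notin> dcircle k"
    using assms(1) by (auto simp: dinterior_def ddisc_def)
  have xu: "\<bar>x\<bar> \<le> \<bar>u\<bar>"
    using u by auto
  show ?thesis
  proof (cases "\<bar>u\<bar> \<le> z")
    case True
    \<comment> \<open>\<open>z = 0\<close> would force \<open>u = x = 0\<close>, a point both on and
      off the circle.\<close>
    have "z \<noteq> 0"
      using True u off assms(2) by auto
    hence "z\<^sup>2 - z < k\<^sup>2 - u\<^sup>2"
      using u(1) dcircle_iff_steep[OF True] by blast
    moreover have "x\<^sup>2 \<le> u\<^sup>2"
      using xu by (simp add: abs_le_square_iff)
    ultimately have lower: "z\<^sup>2 - z < k\<^sup>2 - x\<^sup>2"
      by linarith
    have "z \<le> z\<^sup>2"
      using self_le_power[of z 2] \<open>z \<noteq> 0\<close> assms(2) by auto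
    with lower have "x\<^sup>2 \<le> k\<^sup>2"
      by linarith
    with lower show ?thesis
      using off dcircle_iff_steep[OF assms(2), of k] by linarith
  next
    case False
    hence "0 \<le> z" "z \<le> \<bar>u\<bar>" "\<bar>u\<bar> \<noteq> 0"
      using assms(2) by linarith+
    hence "\<bar>u\<bar>\<^sup>2 - \<bar>u\<bar> < k\<^sup>2 - z\<^sup>2"
      using u(1) dcircle_iff_flat by blast
    \<comment> \<open>Integrality turns \<open>z < \<bar>u\<bar>\<close> into
      \<open>z + 1 \<le> \<bar>u\<bar>\<close>.\<close>
    moreover have "z * (z + 1) \<le> (\<bar>u\<bar> - 1) * \<bar>u\<bar>"
      using False assms(2) by (intro mult_mono) auto
    moreover have "x\<^sup>2 \<le> z\<^sup>2"
      using assms(2) by (simp add: abs_le_square_iff[symmetric])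
    ultimately show ?thesis
      by (simp add: power2_eq_square algebra_simps)
  qed
qed

text \<open>The windows from \<open>a\<^sup>2 - a\<close> (excluded) to \<open>a\<^sup>2 + a\<close>
  (included) tile the positive integers, because
  \<open>(a + 1)\<^sup>2 - (a + 1) = a\<^sup>2 + a\<close>.\<close>

lemma ex_nearest_sqrt:
  fixes n :: int
  assumes "1 \<le> n"
  shows "\<exists>a\<ge>1. a\<^sup>2 - a < n \<and> n \<le> a\<^sup>2 + a"
  using assms
proof (induction n rule: int_ge_induct)
  case base
  show ?case by (intro exI[of _ 1]) simp
next
  case (step n)
  then obtain a where a: "1 \<le> a" "a\<^sup>2 - a < n" "n \<le> a\<^sup>2 + a"
    by blast
  show ?case
  proof (cases "n < a\<^sup>2 + a")
    case True
    with a show ?thesis by (intro exI[of _ a]) auto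
  next
    case False
    with a show ?thesis
      by (intro exI[of _ "a + 1"]) (auto simp: power2_eq_square algebra_simps)
  qed
qed

(* While u < z, stepping from u to u + 1 changes u^2 by less than the width 2 z of the
   window, so the window cannot be jumped over. *)
lemma ex_square_in_window:
  fixes u z n :: int
  assumes "0 \<le> u" "u \<le> z" "z\<^sup>2 - z < n - u\<^sup>2" "n - z\<^sup>2 \<le> z\<^sup>2 + z"
  shows "\<exists>v. u \<le> v \<and> v \<le> z \<and> z\<^sup>2 - z < n - v\<^sup>2 \<and> n - v\<^sup>2 \<le> z\<^sup>2 + z"
  using assms
proof (induction "nat (z - u)" arbitrary: u rule: less_induct)
  case less
  show ?case
  proof (cases "n - u\<^sup>2 \<le> z\<^sup>2 + z")
    case True
    with less.prems show ?thesis by blast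
  next
    case False
    \<comment> \<open>At \<open>u = z\<close> the last hypothesis is the very bound that fails
      here.\<close>
    with less.prems have "u < z"
      by (cases "u = z") auto
    moreover have "z\<^sup>2 - z < n - (u + 1)\<^sup>2"
      using False \<open>u < z\<close> by (simp add: power2_eq_square algebra_simps)
    ultimately obtain v where "u + 1 \<le> v" "v \<le> z" "z\<^sup>2 - z < n - v\<^sup>2" "n - v\<^sup>2 \<le> z\<^sup>2 + z"
      using less.hyps[of "u + 1"] less.prems by auto
    thus ?thesis
      by (intro exI[of _ v]) auto
  qed
qed

text \<open>If the bound failed, the circle would meet row \<open>z\<close> at distance at least
  \<open>\<bar>x\<bar>\<close> from the axis, and the disc would contain
  \<open>(x, z)\<close>.\<close>

lemma dexterior_bound:
  assumes "(x, z) \<in> dexterior m" "\<bar>x\<bar> \<le> z"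
  shows "m\<^sup>2 \<le> x\<^sup>2 + z\<^sup>2 - z"
proof (rule ccontr)
  assume "\<not> ?thesis"
  hence inside: "z\<^sup>2 - z < m\<^sup>2 - \<bar>x\<bar>\<^sup>2"
    by simp
  \<comment> \<open>Both signs of \<open>w\<close> are kept, so that the circle point can be taken
    on the same side as \<open>x\<close>.\<close>
  have "\<exists>v\<ge>\<bar>x\<bar>. \<forall>w. \<bar>w\<bar> = v \<longrightarrow> (w, z) \<in> dcircle m"
  \<comment> \<open>In the first case row \<open>z\<close> meets the circle at or before the
    diagonal; otherwise it does so beyond it, at the rounded square root of
    \<open>m\<^sup>2 - z\<^sup>2\<close>.\<close>
  proof (cases "m\<^sup>2 - z\<^sup>2 \<le> z\<^sup>2 + z")
    case True
    then obtain v where v: "\<bar>x\<bar> \<le> v" "v \<le> z" "z\<^sup>2 - z < m\<^sup>2 - v\<^sup>2" "m\<^sup>2 - v\<^sup>2 \<le> z\<^sup>2 + z"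
      using ex_square_in_window[of "\<bar>x\<bar>" z "m\<^sup>2"] inside assms(2) by auto
    have "z \<le> z\<^sup>2"
      using self_le_power[of z 2] assms(2) by (cases "z = 0") auto
    hence "v\<^sup>2 \<le> m\<^sup>2"
      using v by linarith
    hence "(w, z) \<in> dcircle m" if "\<bar>w\<bar> = v" for w
      using v dcircle_iff_steep[of w z m] unfolding that[symmetric] power2_abs by blast
    with v show ?thesis by blast
  next
    case False
    have "0 \<le> z"
      using assms(2) by linarith
    hence "1 \<le> m\<^sup>2 - z\<^sup>2"
      using False zero_le_power2[of z] by linarith
    then obtain a where a: "1 \<le> a" "a\<^sup>2 - a < m\<^sup>2 - z\<^sup>2" "m\<^sup>2 - z\<^sup>2 \<le> a\<^sup>2 + a"
      using ex_nearest_sqrt by blast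
    have "z < a"
    proof (rule ccontr)
      assume "\<not> z < a"
      hence "a\<^sup>2 \<le> z\<^sup>2"
        using a by (intro power_mono) auto
      with \<open>\<not> z < a\<close> a False show False by linarith
    qed
    have "z\<^sup>2 \<le> m\<^sup>2"
      using \<open>1 \<le> m\<^sup>2 - z\<^sup>2\<close> by linarith
    hence "(w, z) \<in> dcircle m" if "\<bar>w\<bar> = a" for w
      using a \<open>z < a\<close> \<open>0 \<le> z\<close> dcircle_iff_flat[of z w m] unfolding that by linarith
    with \<open>z < a\<close> assms(2) show ?thesis
      by (intro exI[of _ a]) auto
  qed
  then obtain v where v: "\<bar>x\<bar> \<le> v" "\<And>w. \<bar>w\<bar> = v \<Longrightarrow> (w, z) \<in> dcircle m"
    by blast
  have "(x, z) \<in> ddisc m"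
    unfolding ddisc_def using v by (auto intro!: exI[of _ "if 0 \<le> x then v else - v"])
  with assms(1) show False
    by (simp add: dexterior_def)
qed

lemma consecutive_in_generatrix:
  assumes "consecutive r p q"
  shows "p \<in> generatrix r"
proof -
  obtain n where "Suc n < length (generatrix_seq r)" "generatrix_seq r ! n = p"
    using assms unfolding consecutive_def by blast
  hence "p \<in> set (generatrix_seq r)"
    by (metis Suc_lessD nth_mem)
  thus ?thesis
    by (simp only: generatrix_seq)
qed

theorem theorem6:
  fixes r :: int
  assumes "0 < r"
  shows "\<forall>p \<in> absentee_voxels r \<inter> (octant1 \<union> octant8). \<exists>S \<in> family_F. real_point p \<in> S"
proof
  fix p assume p: "p \<in> absentee_voxels r \<inter> (octant1 \<union> octant8)"
  obtain x y z where xyz: "p = (x, y, z)"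
    by (cases p) auto
  have oct: "\<bar>x\<bar> \<le> z"
    using p xyz by (auto simp: octant1_def octant8_def)
  obtain k j' where k: "consecutive r (k - 1, j') (k, y)"
    and int: "(x, z) \<in> dinterior k" and ext: "(x, z) \<in> dexterior (k - 1)"
    using p unfolding xyz absentee_voxels_def in_plane_def by blast
  \<comment> \<open>The predecessor \<open>(k - 1, j')\<close> lies in the first quadrant.\<close>
  have "1 \<le> k"
    using consecutive_in_generatrix[OF k] by (simp add: generatrix_def)
  have upper: "x\<^sup>2 + z\<^sup>2 + z < k\<^sup>2"
    using dinterior_bound[OF int oct] .
  have lower: "(k - 1)\<^sup>2 \<le> x\<^sup>2 + z\<^sup>2 - z"
    using dexterior_bound[OF ext oct] .
  have "z\<^sup>2 < k\<^sup>2"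
    using upper oct zero_le_power2[of x] by linarith
  hence "z < k"
    using \<open>1 \<le> k\<close> power_less_imp_less_base[of z 2 k] by simp
  \<comment> \<open>As \<open>z < k\<close>, \<open>nat\<close> truncates nothing. Substituting
    \<open>k - 1 = z + h\<close> and \<open>k = z + h + 1\<close> cancels \<open>z\<^sup>2\<close>
    in both bounds.\<close>
  define h where "h = nat (k - 1 - z)"
  have h: "k = int h + z + 1"
    using \<open>z < k\<close> by (simp add: h_def)
  have "(2 * int h + 1) * z + (int h)\<^sup>2 \<le> x\<^sup>2"
    using lower unfolding h by (simp add: power2_eq_square algebra_simps)
  hence "real_of_int ((2 * int h + 1) * z + (int h)\<^sup>2) \<le> real_of_int (x\<^sup>2)"
    by (simp only: of_int_le_iff)
  moreover have "x\<^sup>2 < (2 * int h + 1) * z + (int h + 1)\<^sup>2"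
    using upper unfolding h by (simp add: power2_eq_square algebra_simps)
  hence "real_of_int (x\<^sup>2) < real_of_int ((2 * int h + 1) * z + (int h + 1)\<^sup>2)"
    by (simp only: of_int_less_iff)
  ultimately have "real_point p \<in> P_region h"
    by (simp only: xyz real_point_def P_region_def mem_Collect_eq prod.case of_int_add of_int_mult
        of_int_power of_int_numeral of_int_1 of_int_of_nat_eq)
  moreover have "real_point p \<in> Z3_1"
    using oct by (simp add: xyz real_point_def Z3_1_def flip: of_int_abs)
  ultimately show "\<exists>S \<in> family_F. real_point p \<in> S"
    unfolding family_F_def by blast
qed

end
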